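(* Let $R$ be a commutative ring with unit and let $s:\mathbf{Z}_{\ge 0}\to R$ be a function such that (1) $s(0)=0$; (2) $s(n)$ is not a zero-divisor for any $n>0$; (3) $s(n-k)\mid s(n)-s(k)$ for all $n>k>0$. Then, for all integers $n\ge k\ge 0$, the $s$-binomial coefficient $\binom{n}{k}_s$ is an element of $R$, and for all $n>k>0$, $$\binom{n}{k}_s=\binom{n-1}{k-1}_s+\frac{s(n)-s(k)}{s(n-k)}\binom{n-1}{k}_s .$$
   Context: For $n\ge k\ge 0$, $0!_s=1$, $n!_s=\prod_{i=1}^n s(i)$ and $\binom{n}{k}_s=\frac{n!_s}{k!_s(n-k)!_s}$, a priori an element of the localization $R[1/s]=R[s(1)^{-1},s(2)^{-1},\dots]$, of which $R$ is a subring. *)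

theory Defs
  imports "HOL-Algebra.Divisibility" "HOL-Algebra.Ring"
begin

section \<open>Localization of a commutative ring at a multiplicative submonoid\<close>

text \<open>
  The factor \<open>u\<close> in the relation is needed because \<open>S\<close> may contain zero-divisors and the ring
  need not be a domain.
\<close>

definition loc_rel :: "('a, 'b) ring_scheme \<Rightarrow> 'a set \<Rightarrow> (('a \<times> 'a) \<times> ('a \<times> 'a)) set" where
  "loc_rel R S =
     {((a, b), (c, d)). a \<in> carrier R \<and> b \<in> S \<and> c \<in> carrier R \<and> d \<in> S \<and>
        (\<exists>u\<in>S. u \<otimes>\<^bsub>R\<^esub> (a \<otimes>\<^bsub>R\<^esub> d) = u \<otimes>\<^bsub>R\<^esub> (c \<otimes>\<^bsub>R\<^esub> b))}"

definition loc_frac :: "('a, 'b) ring_scheme \<Rightarrow> 'a set \<Rightarrow> 'a \<Rightarrow> 'a \<Rightarrow> ('a \<times> 'a) set" where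
  "loc_frac R S a b = loc_rel R S `` {(a, b)}"

definition localization :: "('a, 'b) ring_scheme \<Rightarrow> 'a set \<Rightarrow> ('a \<times> 'a) set ring" where
  "localization R S =
     \<lparr> carrier = (carrier R \<times> S) // loc_rel R S,
       mult = (\<lambda>X Y. \<Union>p\<in>X. \<Union>q\<in>Y. loc_frac R S (fst p \<otimes>\<^bsub>R\<^esub> fst q) (snd p \<otimes>\<^bsub>R\<^esub> snd q)),
       one = loc_frac R S \<one>\<^bsub>R\<^esub> \<one>\<^bsub>R\<^esub>,
       zero = loc_frac R S \<zero>\<^bsub>R\<^esub> \<one>\<^bsub>R\<^esub>,
       add = (\<lambda>X Y. \<Union>p\<in>X. \<Union>q\<in>Y.
                loc_frac R S (fst p \<otimes>\<^bsub>R\<^esub> snd q \<oplus>\<^bsub>R\<^esub> fst q \<otimes>\<^bsub>R\<^esub> snd p) (snd p \<otimes>\<^bsub>R\<^esub> snd q)) \<rparr>"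

definition loc_embed :: "('a, 'b) ring_scheme \<Rightarrow> 'a set \<Rightarrow> 'a \<Rightarrow> ('a \<times> 'a) set" where
  "loc_embed R S a = loc_frac R S a \<one>\<^bsub>R\<^esub>"

locale localization_at = cring R + submonoid S R for R (structure) and S
begin

lemma S_carrier: "b \<in> S \<Longrightarrow> b \<in> carrier R"
  using subset by blast

lemma equiv_loc_rel: "equiv (carrier R \<times> S) (loc_rel R S)"
proof (rule equivI)
  show "loc_rel R S \<subseteq> (carrier R \<times> S) \<times> (carrier R \<times> S)"
    by (auto simp: loc_rel_def)
  show "refl_on (carrier R \<times> S) (loc_rel R S)"
    by (rule refl_onI) (auto simp: loc_rel_def intro: one_closed)
  show "sym (loc_rel R S)"
    by (rule symI) (auto simp: loc_rel_def intro: sym)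
  show "trans (loc_rel R S)"
  proof (rule transI)
    fix x y z assume xy: "(x, y) \<in> loc_rel R S" and yz: "(y, z) \<in> loc_rel R S"
    obtain a b c d e f where x: "x = (a, b)" and y: "y = (c, d)" and z: "z = (e, f)"
      by (metis surj_pair)
    from xy yz obtain u v where *:
      "a \<in> carrier R" "b \<in> S" "c \<in> carrier R" "d \<in> S" "e \<in> carrier R" "f \<in> S" "u \<in> S" "v \<in> S"
      "u \<otimes> (a \<otimes> d) = u \<otimes> (c \<otimes> b)" "v \<otimes> (c \<otimes> f) = v \<otimes> (e \<otimes> d)"
      by (auto simp: loc_rel_def x y z)
    note C = *(1,3,5) *(2,4,6-8)[THEN S_carrier]
    have "(u \<otimes> v \<otimes> d) \<otimes> (a \<otimes> f) = (v \<otimes> f) \<otimes> (u \<otimes> (a \<otimes> d))"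
      using C by (simp add: m_ac)
    also have "\<dots> = (u \<otimes> b) \<otimes> (v \<otimes> (c \<otimes> f))"
      unfolding *(9) using C by (simp add: m_ac)
    also have "\<dots> = (u \<otimes> v \<otimes> d) \<otimes> (e \<otimes> b)"
      unfolding *(10) using C by (simp add: m_ac)
    finally show "(x, z) \<in> loc_rel R S"
      using * by (auto simp: loc_rel_def x z intro!: bexI[of _ "u \<otimes> v \<otimes> d"])
  qed
qed

lemma loc_frac_eq_iff:
  assumes "a \<in> carrier R" "b \<in> S" "c \<in> carrier R" "d \<in> S"
  shows "loc_frac R S a b = loc_frac R S c d \<longleftrightarrow> (\<exists>u\<in>S. u \<otimes> (a \<otimes> d) = u \<otimes> (c \<otimes> b))"
  using eq_equiv_class_iff[OF equiv_loc_rel, of "(a, b)" "(c, d)"] assms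
  by (simp add: loc_frac_def loc_rel_def)

lemma loc_frac_eqI:
  assumes "a \<in> carrier R" "b \<in> S" "c \<in> carrier R" "d \<in> S" "a \<otimes> d = c \<otimes> b"
  shows "loc_frac R S a b = loc_frac R S c d"
  using loc_frac_eq_iff[OF assms(1-4)] assms(5) one_closed by metis

lemma loc_frac_closed [intro, simp]:
  "a \<in> carrier R \<Longrightarrow> b \<in> S \<Longrightarrow> loc_frac R S a b \<in> carrier (localization R S)"
  by (auto simp: loc_frac_def localization_def intro: quotientI)

lemma carrier_localizationE:
  assumes "X \<in> carrier (localization R S)"
  obtains a b where "a \<in> carrier R" "b \<in> S" "X = loc_frac R S a b"
  using assms by (auto simp: loc_frac_def localization_def elim!: quotientE)

lemma loc_mult_frac:
  assumes "a \<in> carrier R" "b \<in> S" "c \<in> carrier R" "d \<in> S"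
  shows "loc_frac R S a b \<otimes>\<^bsub>localization R S\<^esub> loc_frac R S c d = loc_frac R S (a \<otimes> c) (b \<otimes> d)"
proof -
  let ?f = "\<lambda>p q. loc_frac R S (fst p \<otimes> fst q) (snd p \<otimes> snd q)"
  have "congruent2 (loc_rel R S) (loc_rel R S) ?f"
  proof (rule congruent2I', clarsimp)
    fix a b a' b' c d c' d'
    assume "((a, b), (a', b')) \<in> loc_rel R S" "((c, d), (c', d')) \<in> loc_rel R S"
    then obtain u v where *: "a \<in> carrier R" "a' \<in> carrier R" "c \<in> carrier R" "c' \<in> carrier R"
      "b \<in> S" "b' \<in> S" "d \<in> S" "d' \<in> S" "u \<in> S" "v \<in> S"
      "u \<otimes> (a \<otimes> b') = u \<otimes> (a' \<otimes> b)" "v \<otimes> (c \<otimes> d') = v \<otimes> (c' \<otimes> d)"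
      by (auto simp: loc_rel_def)
    note C = *(1-4) *(5-10)[THEN S_carrier]
    have "(u \<otimes> v) \<otimes> ((a \<otimes> c) \<otimes> (b' \<otimes> d')) = (u \<otimes> (a \<otimes> b')) \<otimes> (v \<otimes> (c \<otimes> d'))"
      using C by (simp add: m_ac)
    also have "\<dots> = (u \<otimes> v) \<otimes> ((a' \<otimes> c') \<otimes> (b \<otimes> d))"
      unfolding *(11,12) using C by (simp add: m_ac)
    finally show "loc_frac R S (a \<otimes> c) (b \<otimes> d) = loc_frac R S (a' \<otimes> c') (b' \<otimes> d')"
      using * by (subst loc_frac_eq_iff) auto
  qed
  from UN_equiv_class2[OF equiv_loc_rel equiv_loc_rel this, of "(a, b)" "(c, d)"] assms
  show ?thesis by (simp add: localization_def loc_frac_def case_prod_unfold)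
qed

lemma loc_add_frac:
  assumes "a \<in> carrier R" "b \<in> S" "c \<in> carrier R" "d \<in> S"
  shows "loc_frac R S a b \<oplus>\<^bsub>localization R S\<^esub> loc_frac R S c d =
    loc_frac R S (a \<otimes> d \<oplus> c \<otimes> b) (b \<otimes> d)"
proof -
  let ?f = "\<lambda>p q. loc_frac R S (fst p \<otimes> snd q \<oplus> fst q \<otimes> snd p) (snd p \<otimes> snd q)"
  have "congruent2 (loc_rel R S) (loc_rel R S) ?f"
  proof (rule congruent2I', clarsimp)
    fix a b a' b' c d c' d'
    assume "((a, b), (a', b')) \<in> loc_rel R S" "((c, d), (c', d')) \<in> loc_rel R S"
    then obtain u v where *: "a \<in> carrier R" "a' \<in> carrier R" "c \<in> carrier R" "c' \<in> carrier R"
      "b \<in> S" "b' \<in> S" "d \<in> S" "d' \<in> S" "u \<in> S" "v \<in> S"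
      "u \<otimes> (a \<otimes> b') = u \<otimes> (a' \<otimes> b)" "v \<otimes> (c \<otimes> d') = v \<otimes> (c' \<otimes> d)"
      by (auto simp: loc_rel_def)
    note C = *(1-4) *(5-10)[THEN S_carrier]
    have "(u \<otimes> v) \<otimes> ((a \<otimes> d \<oplus> c \<otimes> b) \<otimes> (b' \<otimes> d')) =
        (v \<otimes> d \<otimes> d') \<otimes> (u \<otimes> (a \<otimes> b')) \<oplus> (u \<otimes> b \<otimes> b') \<otimes> (v \<otimes> (c \<otimes> d'))"
      using C by (simp add: m_ac l_distr r_distr)
    also have "\<dots> = (u \<otimes> v) \<otimes> ((a' \<otimes> d' \<oplus> c' \<otimes> b') \<otimes> (b \<otimes> d))"
      unfolding *(11,12) using C by (simp add: m_ac l_distr r_distr)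
    finally show "loc_frac R S (a \<otimes> d \<oplus> c \<otimes> b) (b \<otimes> d) =
        loc_frac R S (a' \<otimes> d' \<oplus> c' \<otimes> b') (b' \<otimes> d')"
      using * C by (subst loc_frac_eq_iff) auto
  qed
  from UN_equiv_class2[OF equiv_loc_rel equiv_loc_rel this, of "(a, b)" "(c, d)"] assms
  show ?thesis by (simp add: localization_def loc_frac_def case_prod_unfold)
qed

lemma loc_one: "\<one>\<^bsub>localization R S\<^esub> = loc_frac R S \<one> \<one>"
  and loc_zero: "\<zero>\<^bsub>localization R S\<^esub> = loc_frac R S \<zero> \<one>"
  by (simp_all add: localization_def)

lemma localization_cring: "cring (localization R S)"
proof (rule cringI)
  note frac = loc_mult_frac loc_add_frac loc_one loc_zero S_carrier
  show "abelian_group (localization R S)"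
  proof (rule abelian_groupI)
    fix X Y assume "X \<in> carrier (localization R S)" "Y \<in> carrier (localization R S)"
    then show "X \<oplus>\<^bsub>localization R S\<^esub> Y \<in> carrier (localization R S)"
      by (elim carrier_localizationE) (simp add: frac)
  next
    show "\<zero>\<^bsub>localization R S\<^esub> \<in> carrier (localization R S)"
      by (simp add: frac)
  next
    fix X Y Z
    assume "X \<in> carrier (localization R S)" "Y \<in> carrier (localization R S)"
      "Z \<in> carrier (localization R S)"
    then show "X \<oplus>\<^bsub>localization R S\<^esub> Y \<oplus>\<^bsub>localization R S\<^esub> Z =
        X \<oplus>\<^bsub>localization R S\<^esub> (Y \<oplus>\<^bsub>localization R S\<^esub> Z)"
      by (elim carrier_localizationE) (simp add: frac m_ac l_distr r_distr a_ac)
  next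
    fix X Y assume "X \<in> carrier (localization R S)" "Y \<in> carrier (localization R S)"
    then show "X \<oplus>\<^bsub>localization R S\<^esub> Y = Y \<oplus>\<^bsub>localization R S\<^esub> X"
      by (elim carrier_localizationE) (simp add: frac m_ac a_ac)
  next
    fix X assume "X \<in> carrier (localization R S)"
    then show "\<zero>\<^bsub>localization R S\<^esub> \<oplus>\<^bsub>localization R S\<^esub> X = X"
      by (elim carrier_localizationE) (simp add: frac)
  next
    fix X assume "X \<in> carrier (localization R S)"
    then obtain a b where X: "a \<in> carrier R" "b \<in> S" "X = loc_frac R S a b"
      by (rule carrier_localizationE)
    have b: "b \<in> carrier R" using X(2) by (rule S_carrier)
    have "\<ominus> a \<otimes> b \<oplus> a \<otimes> b = (\<ominus> a \<oplus> a) \<otimes> b"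
      by (rule l_distr[symmetric]) (use X b in simp_all)
    also have "\<dots> = \<zero>"
      using X(1) b by (simp only: l_neg l_null)
    finally have eq: "\<ominus> a \<otimes> b \<oplus> a \<otimes> b = \<zero>" .
    have "loc_frac R S (\<ominus> a) b \<oplus>\<^bsub>localization R S\<^esub> X =
        loc_frac R S (\<ominus> a \<otimes> b \<oplus> a \<otimes> b) (b \<otimes> b)"
      unfolding X(3) by (rule loc_add_frac) (use X(1,2) in simp_all)
    also have "\<dots> = \<zero>\<^bsub>localization R S\<^esub>"
      unfolding eq loc_zero by (rule loc_frac_eqI) (use X(2) b in simp_all)
    finally have "loc_frac R S (\<ominus> a) b \<oplus>\<^bsub>localization R S\<^esub> X = \<zero>\<^bsub>localization R S\<^esub>" .
    then show "\<exists>Y\<in>carrier (localization R S).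
        Y \<oplus>\<^bsub>localization R S\<^esub> X = \<zero>\<^bsub>localization R S\<^esub>"
      using X by blast
  qed
  show "comm_monoid (localization R S)"
  proof (rule comm_monoidI)
    fix X Y assume "X \<in> carrier (localization R S)" "Y \<in> carrier (localization R S)"
    then show "X \<otimes>\<^bsub>localization R S\<^esub> Y \<in> carrier (localization R S)"
      by (elim carrier_localizationE) (simp add: frac)
  next
    show "\<one>\<^bsub>localization R S\<^esub> \<in> carrier (localization R S)"
      by (simp add: frac)
  next
    fix X Y Z
    assume "X \<in> carrier (localization R S)" "Y \<in> carrier (localization R S)"
      "Z \<in> carrier (localization R S)"
    then show "X \<otimes>\<^bsub>localization R S\<^esub> Y \<otimes>\<^bsub>localization R S\<^esub> Z =
        X \<otimes>\<^bsub>localization R S\<^esub> (Y \<otimes>\<^bsub>localization R S\<^esub> Z)"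
      by (elim carrier_localizationE) (simp add: frac m_ac)
  next
    fix X assume "X \<in> carrier (localization R S)"
    then show "\<one>\<^bsub>localization R S\<^esub> \<otimes>\<^bsub>localization R S\<^esub> X = X"
      by (elim carrier_localizationE) (simp add: frac)
  next
    fix X Y assume "X \<in> carrier (localization R S)" "Y \<in> carrier (localization R S)"
    then show "X \<otimes>\<^bsub>localization R S\<^esub> Y = Y \<otimes>\<^bsub>localization R S\<^esub> X"
      by (elim carrier_localizationE) (simp add: frac m_ac)
  qed
next
  fix X Y Z
  assume X: "X \<in> carrier (localization R S)" and Y: "Y \<in> carrier (localization R S)"
    and Z: "Z \<in> carrier (localization R S)"
  obtain a b c d e f where *: "a \<in> carrier R" "b \<in> S" "c \<in> carrier R" "d \<in> S" "e \<in> carrier R" "f \<in> S"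
    "X = loc_frac R S a b" "Y = loc_frac R S c d" "Z = loc_frac R S e f"
    using X Y Z by (elim carrier_localizationE)
  note C = *(1,3,5) *(2,4,6)[THEN S_carrier]
  show "(X \<oplus>\<^bsub>localization R S\<^esub> Y) \<otimes>\<^bsub>localization R S\<^esub> Z =
      X \<otimes>\<^bsub>localization R S\<^esub> Z \<oplus>\<^bsub>localization R S\<^esub> Y \<otimes>\<^bsub>localization R S\<^esub> Z"
    using * C
    by (simp add: loc_mult_frac loc_add_frac, intro loc_frac_eqI) (auto simp: m_ac l_distr r_distr)
qed

lemma loc_embed_hom: "loc_embed R S \<in> ring_hom R (localization R S)"
  by (rule ring_hom_memI)
    (simp_all add: loc_embed_def loc_mult_frac loc_add_frac loc_one)

lemma loc_embed_unit:
  assumes "b \<in> S"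
  shows "loc_embed R S b \<in> Units (localization R S)"
    and "inv\<^bsub>localization R S\<^esub> (loc_embed R S b) = loc_frac R S \<one> b"
proof -
  interpret L: cring "localization R S" by (rule localization_cring)
  have b: "b \<in> carrier R" using assms by (rule S_carrier)
  have eq: "loc_embed R S b \<otimes>\<^bsub>localization R S\<^esub> loc_frac R S \<one> b = \<one>\<^bsub>localization R S\<^esub>"
    using assms b by (simp add: loc_embed_def loc_mult_frac loc_one loc_frac_eqI)
  have C: "loc_embed R S b \<in> carrier (localization R S)"
    "loc_frac R S \<one> b \<in> carrier (localization R S)"
    using assms b by (simp_all add: loc_embed_def)
  show "loc_embed R S b \<in> Units (localization R S)"
    using eq C L.m_comm[OF C] by (auto simp: Units_def)
  show "inv\<^bsub>localization R S\<^esub> (loc_embed R S b) = loc_frac R S \<one> b"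
    using L.comm_inv_char[OF C eq] .
qed

lemma loc_frac_eq_mult_inv:
  assumes "a \<in> carrier R" "b \<in> S"
  shows "loc_frac R S a b =
    loc_embed R S a \<otimes>\<^bsub>localization R S\<^esub> inv\<^bsub>localization R S\<^esub> (loc_embed R S b)"
  unfolding loc_embed_unit(2)[OF assms(2)]
  using assms S_carrier[of b] by (simp add: loc_embed_def loc_mult_frac)

lemma loc_embed_inj:
  assumes "\<And>b x. b \<in> S \<Longrightarrow> x \<in> carrier R \<Longrightarrow> b \<otimes> x = \<zero> \<Longrightarrow> x = \<zero>"
  shows "inj_on (loc_embed R S) (carrier R)"
proof (rule inj_onI)
  fix x y assume *: "x \<in> carrier R" "y \<in> carrier R" "loc_embed R S x = loc_embed R S y"
  then obtain u where u: "u \<in> S" "u \<otimes> x = u \<otimes> y"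
    by (auto simp: loc_embed_def loc_frac_eq_iff)
  then have "u \<otimes> (x \<ominus> y) = \<zero>"
    using * S_carrier[of u] by (simp add: minus_eq r_distr r_minus r_neg)
  then have "x \<oplus> \<ominus> y = \<zero>"
    using assms[OF u(1), of "x \<ominus> y"] * by (simp add: minus_eq)
  then show "x = y"
    using * minus_equality[of x "\<ominus> y"] by simp
qed

end

section \<open>The ring \<open>R[1/s]\<close> and the \<open>s\<close>-binomial coefficients\<close>

text \<open>With this convention \<open>0\<close> is a zero-divisor, except in the zero ring.\<close>

definition zero_divisor :: "('a, 'b) ring_scheme \<Rightarrow> 'a \<Rightarrow> bool" where
  "zero_divisor R a \<longleftrightarrow>
     a \<in> carrier R \<and> (\<exists>x\<in>carrier R. x \<noteq> \<zero>\<^bsub>R\<^esub> \<and> a \<otimes>\<^bsub>R\<^esub> x = \<zero>\<^bsub>R\<^esub>)"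

inductive_set s_denominators :: "('a, 'b) ring_scheme \<Rightarrow> (nat \<Rightarrow> 'a) \<Rightarrow> 'a set"
  for R :: "('a, 'b) ring_scheme" and s :: "nat \<Rightarrow> 'a" where
  one: "\<one>\<^bsub>R\<^esub> \<in> s_denominators R s"
| mult: "a \<in> s_denominators R s \<Longrightarrow> n > 0 \<Longrightarrow> a \<otimes>\<^bsub>R\<^esub> s n \<in> s_denominators R s"

abbreviation s_localization :: "('a, 'b) ring_scheme \<Rightarrow> (nat \<Rightarrow> 'a) \<Rightarrow> ('a \<times> 'a) set ring" where
  "s_localization R s \<equiv> localization R (s_denominators R s)"

text \<open>
  If no \<open>s n\<close> with \<open>n > 0\<close> is a zero-divisor, this map is injective (lemma \<open>s_embed_inj\<close>), and
  its image is the copy of \<open>R\<close> inside \<open>R[1/s]\<close>.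
\<close>

abbreviation s_embed :: "('a, 'b) ring_scheme \<Rightarrow> (nat \<Rightarrow> 'a) \<Rightarrow> 'a \<Rightarrow> ('a \<times> 'a) set" where
  "s_embed R s \<equiv> loc_embed R (s_denominators R s)"

abbreviation s_frac :: "('a, 'b) ring_scheme \<Rightarrow> (nat \<Rightarrow> 'a) \<Rightarrow> 'a \<Rightarrow> 'a \<Rightarrow> ('a \<times> 'a) set" where
  "s_frac R s \<equiv> loc_frac R (s_denominators R s)"

definition s_fact :: "('a, 'b) ring_scheme \<Rightarrow> (nat \<Rightarrow> 'a) \<Rightarrow> nat \<Rightarrow> 'a" where
  "s_fact R s n = (\<Otimes>\<^bsub>R\<^esub>i\<in>{1..n}. s i)"

text \<open>Only meaningful for \<open>k \<le> n\<close>, since subtraction on \<open>nat\<close> truncates.\<close>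

definition s_binomial :: "('a, 'b) ring_scheme \<Rightarrow> (nat \<Rightarrow> 'a) \<Rightarrow> nat \<Rightarrow> nat \<Rightarrow> ('a \<times> 'a) set" where
  "s_binomial R s n k =
     s_frac R s (s_fact R s n) (s_fact R s k \<otimes>\<^bsub>R\<^esub> s_fact R s (n - k))"

context cring
begin

lemma s_denominators_submonoid:
  assumes "s \<in> UNIV \<rightarrow> carrier R"
  shows "submonoid (s_denominators R s) R"
proof
  have s: "s n \<in> carrier R" for n using assms by auto
  show sub: "s_denominators R s \<subseteq> carrier R"
  proof
    fix x assume "x \<in> s_denominators R s"
    then show "x \<in> carrier R" by induction (auto simp: s)
  qed
  show "\<one> \<in> s_denominators R s" by (rule s_denominators.one)
  fix x y assume x: "x \<in> s_denominators R s" and "y \<in> s_denominators R s"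
  from this(2) show "x \<otimes> y \<in> s_denominators R s"
  proof induction
    case one
    then show ?case using x sub by auto
  next
    case (mult a n)
    then have "x \<otimes> (a \<otimes> s n) = (x \<otimes> a) \<otimes> s n"
      using x sub s by (auto simp: m_assoc subset_iff)
    then show ?case using mult s_denominators.mult by metis
  qed
qed

lemma localization_at_s_denominators:
  assumes "s \<in> UNIV \<rightarrow> carrier R"
  shows "localization_at R (s_denominators R s)"
  using s_denominators_submonoid[OF assms] cring_axioms by (simp add: localization_at_def)

lemma s_in_s_denominators:
  assumes "s \<in> UNIV \<rightarrow> carrier R" "n > 0"
  shows "s n \<in> s_denominators R s"
proof -
  have "s n \<in> carrier R" using assms by auto
  then show ?thesis using s_denominators.mult[OF s_denominators.one assms(2), of R s] by simp
qed

lemma s_fact_0: "s_fact R s 0 = \<one>"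
  by (simp add: s_fact_def)

lemma s_fact_Suc:
  assumes "s \<in> UNIV \<rightarrow> carrier R"
  shows "s_fact R s (Suc n) = s_fact R s n \<otimes> s (Suc n)"
proof -
  have *: "s i \<in> carrier R" for i using assms by auto
  show ?thesis
    using * by (simp add: s_fact_def atLeastAtMostSuc_conv m_comm Pi_def)
qed

lemma s_fact_in_s_denominators:
  assumes "s \<in> UNIV \<rightarrow> carrier R"
  shows "s_fact R s n \<in> s_denominators R s"
  by (induction n)
    (simp_all add: s_fact_0 s_fact_Suc[OF assms] s_denominators.one s_denominators.mult)

lemma s_embed_inj:
  assumes "s \<in> UNIV \<rightarrow> carrier R" "\<And>n. n > 0 \<Longrightarrow> \<not> zero_divisor R (s n)"
  shows "inj_on (s_embed R s) (carrier R)"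
proof -
  interpret localization_at R "s_denominators R s"
    by (rule localization_at_s_denominators[OF assms(1)])
  have s: "s n \<in> carrier R" for n using assms(1) by auto
  show ?thesis
  proof (rule loc_embed_inj)
    fix b x assume "b \<in> s_denominators R s" "x \<in> carrier R" "b \<otimes> x = \<zero>"
    then show "x = \<zero>"
    proof (induction arbitrary: x)
      case (mult a n)
      have a: "a \<in> carrier R" using mult.hyps(1) by (rule S_carrier)
      have "a \<otimes> (s n \<otimes> x) = \<zero>"
        using mult.prems m_assoc[OF a s mult.prems(1)] by simp
      then have "s n \<otimes> x = \<zero>"
        by (rule mult.IH[rotated]) (use s mult.prems in simp)
      then show ?case
        using assms(2)[OF mult.hyps(2)] mult.prems(1) s unfolding zero_divisor_def by blast
    qed simp
  qed
qed

end

end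

theory Submission
  imports Defs
begin

text \<open>
  Write \<open>d = n - k\<close>. Both terms of the recurrence acquire the denominator \<open>k!\<^sub>s d!\<^sub>s\<close>: the first by
  expanding by \<open>s k\<close>, since \<open>k!\<^sub>s = (k-1)!\<^sub>s s k\<close>, the second at once, since \<open>d!\<^sub>s = (d-1)!\<^sub>s s d\<close>.
  The numerators are then \<open>(n-1)!\<^sub>s s k\<close> and \<open>(n-1)!\<^sub>s (s n - s k)\<close>, and they add up to
  \<open>(n-1)!\<^sub>s s n = n!\<^sub>s\<close>. This is an identity of fractions, proved in \<open>s_binomial_rec\<close>.

  The divisibility hypothesis says that the coefficient \<open>(s n - s k) / s d\<close> in the recurrence lies in
  the image of \<open>R\<close>. The image is closed under sums and products, and the coefficients with \<open>k = 0\<close>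
  or \<open>k = n\<close> are \<open>1\<close>, so induction on \<open>n\<close> along the recurrence puts every \<open>s\<close>-binomial
  coefficient there (\<open>s_binomial_in_image\<close>).
\<close>

section \<open>Calculating with fractions\<close>

context localization_at
begin

lemma loc_frac_expand:
  assumes "a \<in> carrier R" "b \<in> S" "c \<in> S"
  shows "loc_frac R S (a \<otimes> c) (b \<otimes> c) = loc_frac R S a b"
  using assms S_carrier by (intro loc_frac_eqI) (simp_all add: m_ac)

lemma loc_add_frac_same_denom:
  assumes "a \<in> carrier R" "b \<in> S" "c \<in> carrier R"
  shows "loc_frac R S a b \<oplus>\<^bsub>localization R S\<^esub> loc_frac R S c b = loc_frac R S (a \<oplus> c) b"
proof -
  have b: "b \<in> carrier R" using assms(2) by (rule S_carrier)
  have "loc_frac R S a b \<oplus>\<^bsub>localization R S\<^esub> loc_frac R S c b =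
      loc_frac R S ((a \<oplus> c) \<otimes> b) (b \<otimes> b)"
    using assms b by (simp add: loc_add_frac l_distr)
  also have "\<dots> = loc_frac R S (a \<oplus> c) b"
    using assms by (simp add: loc_frac_expand)
  finally show ?thesis .
qed

lemma loc_frac_eq_embed:
  assumes "q \<in> carrier R" "b \<in> S"
  shows "loc_frac R S (b \<otimes> q) b = loc_embed R S q"
  unfolding loc_embed_def using assms S_carrier by (intro loc_frac_eqI) (simp_all add: m_ac)

lemma loc_frac_self:
  assumes "b \<in> S"
  shows "loc_frac R S b b = loc_embed R S \<one>"
  using loc_frac_eq_embed[OF S_carrier[OF one_closed] assms] S_carrier[OF assms] by simp

lemma loc_embed_image_add:
  assumes "X \<in> loc_embed R S ` carrier R" "Y \<in> loc_embed R S ` carrier R"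
  shows "X \<oplus>\<^bsub>localization R S\<^esub> Y \<in> loc_embed R S ` carrier R"
  using assms by (auto simp: ring_hom_add[OF loc_embed_hom, symmetric])

lemma loc_embed_image_mult:
  assumes "X \<in> loc_embed R S ` carrier R" "Y \<in> loc_embed R S ` carrier R"
  shows "X \<otimes>\<^bsub>localization R S\<^esub> Y \<in> loc_embed R S ` carrier R"
  using assms by (auto simp: ring_hom_mult[OF loc_embed_hom, symmetric])

end

section \<open>The recurrence and integrality\<close>

context cring
begin

lemma s_binomial_0:
  assumes "s \<in> UNIV \<rightarrow> carrier R"
  shows "s_binomial R s n 0 = s_embed R s \<one>"
proof -
  interpret localization_at R "s_denominators R s"
    by (rule localization_at_s_denominators[OF assms])
  show ?thesis
    using s_fact_in_s_denominators[OF assms, of n] S_carrier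
    by (simp add: s_binomial_def s_fact_0 loc_frac_self)
qed

lemma s_binomial_self:
  assumes "s \<in> UNIV \<rightarrow> carrier R"
  shows "s_binomial R s n n = s_embed R s \<one>"
proof -
  interpret localization_at R "s_denominators R s"
    by (rule localization_at_s_denominators[OF assms])
  show ?thesis
    using s_fact_in_s_denominators[OF assms, of n] S_carrier
    by (simp add: s_binomial_def s_fact_0 loc_frac_self)
qed

text \<open>
  The indices are shifted to \<open>n = m + 1\<close> and \<open>k = j + 1\<close> so that the factorials unfold without
  truncated subtraction.
\<close>

lemma s_binomial_rec:
  assumes s: "s \<in> UNIV \<rightarrow> carrier R" and "j < m"
  shows "s_binomial R s (Suc m) (Suc j) =
    s_binomial R s m j \<oplus>\<^bsub>s_localization R s\<^esub>
    s_frac R s (s (Suc m) \<ominus> s (Suc j)) (s (m - j)) \<otimes>\<^bsub>s_localization R s\<^esub> s_binomial R s m (Suc j)"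
proof -
  interpret localization_at R "s_denominators R s"
    by (rule localization_at_s_denominators[OF s])
  let ?L = "s_localization R s" and ?F = "s_fact R s"
  define e where "e = m - Suc j"
  have d: "m - j = Suc e" using \<open>j < m\<close> by (simp add: e_def)
  have sc [simp]: "s i \<in> carrier R" for i using s by auto
  have sS [simp]: "s (Suc i) \<in> s_denominators R s" for i by (simp add: s_in_s_denominators[OF s])
  have FS [simp]: "?F i \<in> s_denominators R s" for i by (rule s_fact_in_s_denominators[OF s])
  have Fc [simp]: "?F i \<in> carrier R" for i using FS by (rule S_carrier)
  note Suc = s_fact_Suc[OF s]
  define D where "D = ?F (Suc j) \<otimes> ?F (Suc e)"
  have D: "D \<in> s_denominators R s" by (simp add: D_def)
  have first: "s_binomial R s m j = s_frac R s (?F m \<otimes> s (Suc j)) D"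
  proof -
    have "D = ?F j \<otimes> ?F (Suc e) \<otimes> s (Suc j)"
      unfolding D_def Suc[of j] by (simp add: m_ac)
    then show ?thesis by (simp add: s_binomial_def d loc_frac_expand)
  qed
  have second: "s_frac R s (s (Suc m) \<ominus> s (Suc j)) (s (m - j)) \<otimes>\<^bsub>?L\<^esub> s_binomial R s m (Suc j) =
      s_frac R s (?F m \<otimes> (s (Suc m) \<ominus> s (Suc j))) D"
  proof -
    have "D = s (Suc e) \<otimes> (?F (Suc j) \<otimes> ?F e)"
      unfolding D_def Suc[of e] by (simp add: m_ac)
    then show ?thesis
      by (simp add: s_binomial_def d e_def[symmetric] loc_mult_frac m_comm)
  qed
  have "?F m \<otimes> s (Suc j) \<oplus> ?F m \<otimes> (s (Suc m) \<ominus> s (Suc j)) =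
      ?F m \<otimes> (s (Suc j) \<oplus> (s (Suc m) \<ominus> s (Suc j)))"
    by (simp add: r_distr)
  also have "s (Suc j) \<oplus> (s (Suc m) \<ominus> s (Suc j)) = s (Suc m)"
    unfolding minus_eq by (subst a_lcomm) (simp_all add: r_neg)
  finally have "?F m \<otimes> s (Suc j) \<oplus> ?F m \<otimes> (s (Suc m) \<ominus> s (Suc j)) = ?F (Suc m)"
    by (simp add: Suc)
  moreover have "s_binomial R s (Suc m) (Suc j) = s_frac R s (?F (Suc m)) D"
    by (simp add: s_binomial_def d D_def)
  ultimately show ?thesis
    unfolding first second using D by (simp add: loc_add_frac_same_denom)
qed

lemma s_binomial_in_image:
  assumes s: "s \<in> UNIV \<rightarrow> carrier R"
    and dvd: "\<And>n k. n > k \<Longrightarrow> k > 0 \<Longrightarrow> s (n - k) divides (s n \<ominus> s k)"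
    and "k \<le> n"
  shows "s_binomial R s n k \<in> s_embed R s ` carrier R"
  using \<open>k \<le> n\<close>
proof (induction n arbitrary: k)
  case 0
  then show ?case by (simp add: s_binomial_0[OF s])
next
  case (Suc m)
  interpret localization_at R "s_denominators R s"
    by (rule localization_at_s_denominators[OF s])
  consider "k = 0" | "k = Suc m" | j where "k = Suc j" "j < m"
    using Suc.prems by (cases k) force+
  then show ?case
  proof cases
    case 1
    then show ?thesis by (simp add: s_binomial_0[OF s])
  next
    case 2
    then show ?thesis by (simp add: s_binomial_self[OF s])
  next
    case 3
    obtain q where q: "q \<in> carrier R" "s (Suc m) \<ominus> s (Suc j) = s (m - j) \<otimes> q"
      using dvd[of "Suc j" "Suc m"] \<open>j < m\<close> by (auto elim: dividesE)
    have "s (m - j) \<in> s_denominators R s"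
      using \<open>j < m\<close> by (simp add: s_in_s_denominators[OF s])
    then have "s_frac R s (s (Suc m) \<ominus> s (Suc j)) (s (m - j)) \<in> s_embed R s ` carrier R"
      using q by (simp add: loc_frac_eq_embed)
    then show ?thesis
      unfolding \<open>k = Suc j\<close> s_binomial_rec[OF s \<open>j < m\<close>]
      using Suc.IH \<open>j < m\<close> by (intro loc_embed_image_add loc_embed_image_mult) simp_all
  qed
qed

end

theorem proposition2p1p3:
  fixes R :: "('a, 'b) ring_scheme" (structure)
    and s :: "nat \<Rightarrow> 'a"
  assumes "cring R"
    and "s \<in> UNIV \<rightarrow> carrier R"
    and "s 0 = \<zero>"
    and "\<And>n. n > 0 \<Longrightarrow> \<not> zero_divisor R (s n)"
    and "\<And>n k. n > k \<Longrightarrow> k > 0 \<Longrightarrow> s (n - k) divides (s n \<ominus> s k)"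
  shows "(\<forall>n k. n \<ge> k \<longrightarrow> s_binomial R s n k \<in> s_embed R s ` carrier R) \<and>
    (\<forall>n k. n > k \<and> k > 0 \<longrightarrow>
       s_binomial R s n k =
         s_binomial R s (n - 1) (k - 1) \<oplus>\<^bsub>s_localization R s\<^esub>
         s_frac R s (s n \<ominus> s k) (s (n - k)) \<otimes>\<^bsub>s_localization R s\<^esub> s_binomial R s (n - 1) k)"
proof -
  interpret cring R by (rule assms(1))
  show ?thesis
  proof (intro conjI allI impI)
    fix n k :: nat assume "k \<le> n"
    then show "s_binomial R s n k \<in> s_embed R s ` carrier R"
      by (intro s_binomial_in_image assms(2,5))
  next
    fix n k :: nat assume "k < n \<and> 0 < k"
    then obtain m j where "n = Suc m" "k = Suc j" "j < m"
      by (cases n; cases k) auto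
    then show "s_binomial R s n k =
        s_binomial R s (n - 1) (k - 1) \<oplus>\<^bsub>s_localization R s\<^esub>
        s_frac R s (s n \<ominus> s k) (s (n - k)) \<otimes>\<^bsub>s_localization R s\<^esub> s_binomial R s (n - 1) k"
      using s_binomial_rec[OF assms(2)] by simp
  qed
qed

end
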